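(* Let $k\ge 3$ and $0\le\alpha<1$. Let $G$ be a connected $k$-uniform hypergraph on $n$ vertices with $m$ edges, and let $S$ be a nonempty subset of $V(G)$ with $|S|=s$. Then $$\rho_{\alpha}(G)-\frac{km}{n}\ \ge\ \frac{\alpha}{k^{k}n}\sum_{i\in S}d_{i}\left(\left(\sqrt[k]{\frac{s\,d_{i}^{\frac{k}{k-1}}}{\sum_{j\in S}d_{j}^{\frac{k}{k-1}}}}+k-1\right)^{k}-k^{k}\right)+\frac{1-\alpha}{n}\left(s^{\frac1k}\left(\sum_{i\in S}d_{i}^{\frac{k}{k-1}}\right)^{\frac{k-1}{k}}-\sum_{i\in S}d_{i}\right).$$
   Context: A $k$-uniform hypergraph $G=(V(G),E(G))$ has a finite vertex set $V(G)$ (identified with $[n]=\{1,\dots,n\}$) and an edge set $E(G)$ consisting of distinct $k$-element subsets of $V(G)$; hypergraphs are assumed to have at least one edge. The degree $d_i$ of a vertex $i$ is the number of edges containing $i$. $G$ is connected if every two vertices $u,v$ are joined by a sequence $u=v_1,e_1,v_2,\dots,e_\ell,v_{\ell+1}=v$ with $e_t\in E(G)$ and $\{v_t,v_{t+1}\}\subseteq e_t$. The adjacency tensor $\mathcal{A}(G)$ is the tensor of order $k$ and dimension $n$ with entries $a_{i_1\ldots i_k}=\frac{1}{(k-1)!}$ if $\{i_1,\dots,i_k\}\in E(G)$ and $0$ otherwise; $\mathcal{D}(G)$ is the diagonal tensor of order $k$ and dimension $n$ with diagonal entries $d_{i\ldots i}=d_i$ and all other entries $0$. For $0\le\alpha<1$,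 $\mathcal{A}_\alpha(G)=\alpha\mathcal{D}(G)+(1-\alpha)\mathcal{A}(G)$. For a tensor $\mathcal{T}=(t_{i_1\ldots i_k})$ of order $k$ and dimension $n$ and $x\in\mathbb{C}^n$, $(\mathcal{T}x)_i=\sum_{i_2,\dots,i_k=1}^n t_{ii_2\ldots i_k}x_{i_2}\cdots x_{i_k}$. A number $\lambda\in\mathbb{C}$ is an eigenvalue of $\mathcal{T}$ with eigenvector $0\ne x\in\mathbb{C}^n$ if $(\mathcal{T}x)_i=\lambda x_i^{k-1}$ for all $i$; the spectral radius $\rho(\mathcal{T})$ is the maximum of $|\lambda|$ over eigenvalues $\lambda$ of $\mathcal{T}$. $\rho_\alpha(G)=\rho(\mathcal{A}_\alpha(G))$. *)

theory Defs
  imports "HOL-Analysis.Analysis"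
begin

section \<open>Uniform hypergraphs\<close>

definition uniform_hypergraph :: "nat \<Rightarrow> 'a set \<Rightarrow> 'a set set \<Rightarrow> bool" where
  "uniform_hypergraph k V E \<longleftrightarrow>
     finite V \<and> E \<noteq> {} \<and> (\<forall>e\<in>E. e \<subseteq> V \<and> card e = k)"

definition vertex_degree :: "'a set set \<Rightarrow> 'a \<Rightarrow> nat" where
  "vertex_degree E i = card {e \<in> E. i \<in> e}"

(* vs lists the vertices and es the edges of a walk u = v_1, e_1, v_2, ..., e_l, v_(l+1) = v. *)
definition hypergraph_connected :: "'a set \<Rightarrow> 'a set set \<Rightarrow> bool" where
  "hypergraph_connected V E \<longleftrightarrow>
     (\<forall>u\<in>V. \<forall>v\<in>V. \<exists>vs es.
        length vs = Suc (length es) \<and> hd vs = u \<and> last vs = v \<and>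
        (\<forall>t<length es. es ! t \<in> E \<and> {vs ! t, vs ! Suc t} \<subseteq> es ! t))"

section \<open>Tensors and their eigenvalues\<close>

(* A tensor of order k and dimension n is a family of entries t_(i_1 ... i_k) with indices in an
   n-element set I, here a function on index lists. Only its values on lists of length k over I
   are relevant; likewise only the values on I of a vector x :: 'a => complex. *)
type_synonym 'a tensor = "'a list \<Rightarrow> complex"

definition tensor_apply :: "nat \<Rightarrow> 'a set \<Rightarrow> 'a tensor \<Rightarrow> ('a \<Rightarrow> complex) \<Rightarrow> 'a \<Rightarrow> complex" where
  "tensor_apply k I T x i =
     (\<Sum>js \<in> {js. set js \<subseteq> I \<and> length js = k - 1}. T (i # js) * (\<Prod>j\<leftarrow>js. x j))"

definition tensor_eigenpair ::
    "nat \<Rightarrow> 'a set \<Rightarrow> 'a tensor \<Rightarrow> complex \<Rightarrow> ('a \<Rightarrow> complex) \<Rightarrow> bool" where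
  "tensor_eigenpair k I T \<mu> x \<longleftrightarrow>
     (\<exists>i\<in>I. x i \<noteq> 0) \<and> (\<forall>i\<in>I. tensor_apply k I T x i = \<mu> * x i ^ (k - 1))"

definition tensor_eigenvalues :: "nat \<Rightarrow> 'a set \<Rightarrow> 'a tensor \<Rightarrow> complex set" where
  "tensor_eigenvalues k I T = {\<mu>. \<exists>x. tensor_eigenpair k I T \<mu> x}"

(* The supremum is a maximum: see tensor_spectral_radius_attained and tensor_spectral_radius_upper below. *)
definition tensor_spectral_radius :: "nat \<Rightarrow> 'a set \<Rightarrow> 'a tensor \<Rightarrow> real" where
  "tensor_spectral_radius k I T = (SUP \<mu> \<in> tensor_eigenvalues k I T. cmod \<mu>)"

section \<open>The tensors of a hypergraph\<close>

definition adjacency_tensor :: "nat \<Rightarrow> 'a set set \<Rightarrow> 'a tensor" where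
  "adjacency_tensor k E js = (if set js \<in> E then 1 / fact (k - 1) else 0)"

definition degree_tensor :: "nat \<Rightarrow> 'a set set \<Rightarrow> 'a tensor" where
  "degree_tensor k E js =
     (if js = replicate k (hd js) then of_nat (vertex_degree E (hd js)) else 0)"

definition A_alpha :: "nat \<Rightarrow> 'a set set \<Rightarrow> real \<Rightarrow> 'a tensor" where
  "A_alpha k E \<alpha> js =
     of_real \<alpha> * degree_tensor k E js + of_real (1 - \<alpha>) * adjacency_tensor k E js"

definition rho_alpha :: "nat \<Rightarrow> 'a set \<Rightarrow> 'a set set \<Rightarrow> real \<Rightarrow> real" where
  "rho_alpha k V E \<alpha> = tensor_spectral_radius k V (A_alpha k E \<alpha>)"

section \<open>The spectral radius is a maximum\<close>

lemma prod_list_scale: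
  "(\<Prod>j\<leftarrow>js. c * x j) = c ^ length js * (\<Prod>j\<leftarrow>js. x j :: complex)"
  by (induction js) (auto simp: algebra_simps)

lemma tensor_eigenpair_scale:
  assumes "tensor_eigenpair k I T \<mu> x" "c \<noteq> 0"
  shows "tensor_eigenpair k I T \<mu> (\<lambda>i. c * x i)"
proof -
  have "tensor_apply k I T (\<lambda>i. c * x i) i = c ^ (k - 1) * tensor_apply k I T x i" for i
    unfolding tensor_apply_def sum_distrib_left
    by (intro sum.cong) (auto simp: prod_list_scale)
  then show ?thesis
    using assms by (auto simp: tensor_eigenpair_def power_mult_distrib)
qed

lemma tensor_apply_cong:
  assumes "\<And>i. i \<in> I \<Longrightarrow> x i = y i"
  shows "tensor_apply k I T x = tensor_apply k I T y"
proof
  fix i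
  have "map x js = map y js" if "set js \<subseteq> I" for js
    using that assms by (auto intro: map_cong)
  then show "tensor_apply k I T x i = tensor_apply k I T y i"
    unfolding tensor_apply_def by (intro sum.cong refl) (metis (mono_tags) mem_Collect_eq)
qed

lemma norm_prod_list_le_1:
  "(\<And>j. j \<in> set js \<Longrightarrow> cmod (x j) \<le> 1) \<Longrightarrow> cmod (\<Prod>j\<leftarrow>js. x j) \<le> 1"
proof (induction js)
  case (Cons a js)
  then have "cmod (x a) * cmod (\<Prod>j\<leftarrow>js. x j) \<le> 1 * 1"
    by (intro mult_mono) auto
  then show ?case by (simp add: norm_mult)
qed auto

lemma tensor_eigenpair_normalize:
  assumes "finite I" "tensor_eigenpair k I T \<mu> x"
  obtains y where "tensor_eigenpair k I T \<mu> y" "\<And>i. cmod (y i) \<le> 1"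
    "\<And>i. i \<notin> I \<Longrightarrow> y i = 0" "\<exists>i\<in>I. cmod (y i) = 1"
proof -
  obtain i0 where i0: "i0 \<in> I" "x i0 \<noteq> 0"
    using assms(2) by (auto simp: tensor_eigenpair_def)
  define M where "M = Max ((\<lambda>i. cmod (x i)) ` I)"
  have ub: "cmod (x i) \<le> M" if "i \<in> I" for i
    unfolding M_def using that assms(1) by auto
  have "0 < cmod (x i0)" using i0 by simp
  with ub[OF i0(1)] have M: "M > 0" by linarith
  have "M \<in> (\<lambda>i. cmod (x i)) ` I"
    unfolding M_def using assms(1) i0 by (intro Max_in) auto
  then obtain i1 where i1: "i1 \<in> I" "cmod (x i1) = M" by auto
  define z where "z = (\<lambda>i. of_real (1 / M) * x i)"
  define y where "y = (\<lambda>i. if i \<in> I then z i else 0)"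
  have "tensor_eigenpair k I T \<mu> z"
    unfolding z_def using M by (intro tensor_eigenpair_scale assms) auto
  moreover have "tensor_apply k I T y = tensor_apply k I T z"
    by (rule tensor_apply_cong) (auto simp: y_def)
  ultimately have "tensor_eigenpair k I T \<mu> y"
    by (auto simp: tensor_eigenpair_def y_def)
  moreover have "cmod (y i) \<le> 1" for i
    using ub[of i] M by (auto simp: y_def z_def norm_mult norm_divide divide_simps)
  moreover have "cmod (y i1) = 1"
    using i1 M by (auto simp: y_def z_def norm_mult norm_divide)
  ultimately show ?thesis
    using i1(1) by (intro that[of y]) (auto simp: y_def)
qed

lemma compact_tensor_eigenvalues:
  assumes I: "finite I"
  shows "compact (tensor_eigenvalues k I T)"
proof -
  let ?J = "{js. set js \<subseteq> I \<and> length js = k - 1}"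
  have finJ: "finite ?J" by (rule finite_lists_length_eq[OF I])
  define B where "B = (\<Sum>i\<in>I. \<Sum>js\<in>?J. cmod (T (i # js)))"
  define P :: "('a \<Rightarrow> complex) set" where
    "P = PiE UNIV (\<lambda>i. if i \<in> I then cball 0 1 else {0})"
  define K where "K = cball (0::complex) B \<times> P"
  have "compactin (product_topology (\<lambda>i::'a. euclidean :: complex topology) UNIV) P"
    unfolding P_def by (subst compactin_PiE) auto
  then have "compact P"
    by (simp add: euclidean_product_topology)
  then have cK: "compact K"
    unfolding K_def by (intro compact_Times) auto
  define C where "C = (\<Inter>i\<in>I. {p. tensor_apply k I T (snd p) i = fst p * snd p i ^ (k - 1)})
    \<inter> (\<Union>i\<in>I. {p :: complex \<times> ('a \<Rightarrow> complex). cmod (snd p i) = 1})"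
  have coord: "continuous_on UNIV (\<lambda>p :: complex \<times> ('a \<Rightarrow> complex). snd p i)" for i
    by (rule continuous_on_product_then_coordinatewise) (intro continuous_intros)
  have cprod: "continuous_on UNIV (\<lambda>p :: complex \<times> ('a \<Rightarrow> complex). \<Prod>j\<leftarrow>js. snd p j)" for js
    by (induction js) (auto intro!: continuous_on_mult coord)
  have "closed C"
    unfolding C_def tensor_apply_def
    by (intro closed_Int closed_INT closed_UN ballI I closed_Collect_eq
        continuous_intros coord cprod)
  with cK have "compact (K \<inter> C)" by (rule compact_Int_closed)
  then have "compact (fst ` (K \<inter> C))"
    by (intro compact_continuous_image continuous_intros)
  moreover have "fst ` (K \<inter> C) = tensor_eigenvalues k I T"
  proof (intro equalityI subsetI)
    fix \<mu> assume "\<mu> \<in> fst ` (K \<inter> C)"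
    then obtain x where "(\<mu>, x) \<in> C" by auto
    then have "tensor_eigenpair k I T \<mu> x"
      unfolding C_def tensor_eigenpair_def
      by (metis (mono_tags, lifting) IntE INT_E UN_E mem_Collect_eq fst_conv snd_conv norm_zero zero_neq_one)
    then show "\<mu> \<in> tensor_eigenvalues k I T"
      by (auto simp: tensor_eigenvalues_def)
  next
    fix \<mu> assume "\<mu> \<in> tensor_eigenvalues k I T"
    then obtain x where "tensor_eigenpair k I T \<mu> x"
      by (auto simp: tensor_eigenvalues_def)
    then obtain y where y: "tensor_eigenpair k I T \<mu> y" "\<And>i. cmod (y i) \<le> 1"
      "\<And>i. i \<notin> I \<Longrightarrow> y i = 0" "\<exists>i\<in>I. cmod (y i) = 1"
      by (rule tensor_eigenpair_normalize[OF I]) (rule that)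
    obtain i where i: "i \<in> I" "cmod (y i) = 1" using y(4) by auto
    have "cmod \<mu> = cmod (\<mu> * y i ^ (k - 1))"
      using i by (simp add: norm_mult norm_power)
    also have "\<dots> = cmod (tensor_apply k I T y i)"
      using y(1) i by (simp add: tensor_eigenpair_def)
    also have "\<dots> \<le> (\<Sum>js\<in>?J. cmod (T (i # js) * (\<Prod>j\<leftarrow>js. y j)))"
      unfolding tensor_apply_def by (rule norm_sum)
    also have "\<dots> \<le> (\<Sum>js\<in>?J. cmod (T (i # js)))"
      by (intro sum_mono) (auto simp: norm_mult intro!: mult_left_le norm_prod_list_le_1 y)
    also have "\<dots> \<le> B"
      unfolding B_def using I i
      by (intro member_le_sum[where f = "\<lambda>i. \<Sum>js\<in>?J. cmod (T (i # js))"] sum_nonneg) auto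
    finally have "(\<mu>, y) \<in> K"
      using y(2,3) by (auto simp: K_def P_def)
    moreover have "(\<mu>, y) \<in> C"
      using y(1,4) by (auto simp: C_def tensor_eigenpair_def)
    ultimately show "\<mu> \<in> fst ` (K \<inter> C)" by force
  qed
  ultimately show ?thesis by simp
qed

lemma tensor_spectral_radius_attained:
  assumes "finite I" "tensor_eigenvalues k I T \<noteq> {}"
  shows "\<exists>\<mu>\<in>tensor_eigenvalues k I T. tensor_spectral_radius k I T = cmod \<mu>"
proof -
  obtain \<mu> where \<mu>: "\<mu> \<in> tensor_eigenvalues k I T"
    "\<And>\<nu>. \<nu> \<in> tensor_eigenvalues k I T \<Longrightarrow> cmod \<nu> \<le> cmod \<mu>"
    using continuous_attains_sup[OF compact_tensor_eigenvalues[OF assms(1)] assms(2)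
        continuous_on_norm[OF continuous_on_id]] by auto
  then have "tensor_spectral_radius k I T = cmod \<mu>"
    unfolding tensor_spectral_radius_def by (intro cSup_eq_maximum) auto
  with \<mu>(1) show ?thesis by blast
qed

lemma tensor_spectral_radius_upper:
  assumes "finite I" "\<mu> \<in> tensor_eigenvalues k I T"
  shows "cmod \<mu> \<le> tensor_spectral_radius k I T"
  unfolding tensor_spectral_radius_def
proof (rule cSUP_upper[OF assms(2)])
  show "bdd_above (cmod ` tensor_eigenvalues k I T)"
    by (intro bounded_imp_bdd_above compact_imp_bounded compact_continuous_image
        compact_tensor_eigenvalues assms(1) continuous_intros)
qed

end

theory Submission
  imports Defs "HOL-Combinatorics.Multiset_Permutations"
begin

text \<open>A maximiser of the form \<open>x\<^sup>T(A\<^sub>\<alpha>x)\<close> over the nonnegative unit sphere of the \<open>k\<close>-norm is, for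
  connected \<open>G\<close>, a positive eigenvector. Dividing by it, AM-GM on every edge gives for each
  \<open>y \<ge> 0\<close> the inequality
  \<open>\<alpha> \<Sum> d\<^sub>i (y\<^sub>i\<^sup>k + k - 1)/k + (1 - \<alpha>) \<Sum> d\<^sub>i y\<^sub>i \<le> \<rho>\<^sub>\<alpha> \<Sum> (y\<^sub>i\<^sup>k + k - 1)/k\<close>.
  It is applied to the vector \<open>y\<close> that is \<open>1\<close> off \<open>S\<close> and on \<open>S\<close> attains equality in Hoelder's
  inequality for \<open>\<Sum> d\<^sub>i y\<^sub>i\<close>, and convexity of \<open>z\<^sup>k\<close> bounds \<open>((y\<^sub>i + k - 1)/k)\<^sup>k\<close> by
  \<open>(y\<^sub>i\<^sup>k + k - 1)/k\<close>.\<close>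

section \<open>Counting incidences, and the action of the tensors on a vector\<close>

lemma uniform_hypergraph_finite_edges:
  assumes "uniform_hypergraph k V E"
  shows "finite E"
proof -
  have "E \<subseteq> Pow V" using assms by (auto simp: uniform_hypergraph_def)
  then show ?thesis
    using assms by (auto simp: uniform_hypergraph_def intro: finite_subset)
qed

lemma uniform_hypergraph_finite_edge:
  assumes "uniform_hypergraph k V E" "e \<in> E"
  shows "finite e"
  using assms unfolding uniform_hypergraph_def by (metis finite_subset)

text \<open>Double counting of incident pairs. With \<open>f\<close> constantly 1 it becomes the
  handshake identity: the degrees sum to \<open>k\<close> times the number of edges.\<close>

lemma sum_edges_sum_vertices:
  fixes f :: "'a \<Rightarrow> real"
  assumes "uniform_hypergraph k V E"
  shows "(\<Sum>e\<in>E. \<Sum>i\<in>e. f i) = (\<Sum>i\<in>V. real (vertex_degree E i) * f i)"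
proof -
  have "(\<Sum>e\<in>E. \<Sum>i\<in>e. f i) = (\<Sum>e\<in>E. \<Sum>i | i \<in> V \<and> i \<in> e. f i)"
    using assms by (intro sum.cong refl) (auto simp: uniform_hypergraph_def)
  also have "\<dots> = (\<Sum>i\<in>V. \<Sum>e | e \<in> E \<and> i \<in> e. f i)"
    using assms uniform_hypergraph_finite_edges[OF assms]
    by (intro sum.swap_restrict) (auto simp: uniform_hypergraph_def)
  finally show ?thesis by (simp add: vertex_degree_def)
qed

text \<open>The index lists that complete \<open>i\<close> to an edge \<open>e\<close> are the
  orderings of \<open>e - {i}\<close>. There are \<open>(k - 1)!\<close> of them, all with the same
  product, which cancels the entry \<open>1 / fact (k - 1)\<close>.\<close>

lemma tensor_apply_adjacency_tensor:
  assumes G: "uniform_hypergraph k V E" and "k > 0" and i: "i \<in> V"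
  shows "tensor_apply k V (adjacency_tensor k E) x i = (\<Sum>e | e \<in> E \<and> i \<in> e. \<Prod>j\<in>e - {i}. x j)"
proof -
  let ?J = "{js. set js \<subseteq> V \<and> length js = k - 1}"
  have finJ: "finite ?J"
    using G by (intro finite_lists_length_eq) (simp add: uniform_hypergraph_def)
  have finE: "finite E" by (rule uniform_hypergraph_finite_edges[OF G])
  \<comment> \<open>The case distinction in the tensor entry is written as a sum over at most one
    edge, so that the sums over lists and edges can be exchanged.\<close>
  have "tensor_apply k V (adjacency_tensor k E) x i =
      (\<Sum>js\<in>?J. \<Sum>e | e \<in> E \<and> insert i (set js) = e. (\<Prod>j\<leftarrow>js. x j) / fact (k - 1))"
    unfolding tensor_apply_def
  proof (intro sum.cong refl)
    fix js
    have "{e. e \<in> E \<and> insert i (set js) = e} = (if insert i (set js) \<in> E then {insert i (set js)} else {})"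
      by auto
    then show "adjacency_tensor k E (i # js) * (\<Prod>j\<leftarrow>js. x j) =
        (\<Sum>e | e \<in> E \<and> insert i (set js) = e. (\<Prod>j\<leftarrow>js. x j) / fact (k - 1))"
      by (simp add: adjacency_tensor_def)
  qed
  also have "\<dots> = (\<Sum>e\<in>E. \<Sum>js | js \<in> ?J \<and> insert i (set js) = e. (\<Prod>j\<leftarrow>js. x j) / fact (k - 1))"
    by (rule sum.swap_restrict[OF finJ finE])
  also have "\<dots> = (\<Sum>e\<in>E. if i \<in> e then \<Prod>j\<in>e - {i}. x j else 0)"
  proof (intro sum.cong refl)
    fix e assume e: "e \<in> E"
    have fe: "finite e" by (rule uniform_hypergraph_finite_edge[OF G e])
    have ce: "card e = k" "e \<subseteq> V" using G e by (auto simp: uniform_hypergraph_def)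
    show "(\<Sum>js | js \<in> ?J \<and> insert i (set js) = e. (\<Prod>j\<leftarrow>js. x j) / fact (k - 1)) =
        (if i \<in> e then \<Prod>j\<in>e - {i}. x j else 0)"
    proof (cases "i \<in> e")
      case True
      have ci: "card (e - {i}) = k - 1" using True ce fe by simp
      have eq: "{js. js \<in> ?J \<and> insert i (set js) = e} = permutations_of_set (e - {i})"
      proof (intro equalityI subsetI)
        fix js assume js: "js \<in> {js. js \<in> ?J \<and> insert i (set js) = e}"
        then have sub: "e - {i} \<subseteq> set js" by auto
        \<comment> \<open>The \<open>k - 1\<close> entries of \<open>js\<close> must already cover
          the \<open>k - 1\<close> vertices of \<open>e - {i}\<close>, so none is spent on
          \<open>i\<close> and none is repeated.\<close>
        have "card (set js) \<le> k - 1" using js card_length[of js] by auto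
        then have "set js = e - {i}"
          using card_seteq[OF _ sub] ci by simp
        moreover from this have "distinct js"
          using js ci by (intro card_distinct) auto
        ultimately show "js \<in> permutations_of_set (e - {i})"
          by (simp add: permutations_of_set_def)
      next
        fix js assume "js \<in> permutations_of_set (e - {i})"
        then have js: "set js = e - {i}" "distinct js" by (auto simp: permutations_of_set_def)
        then have "length js = k - 1" using ci distinct_card[of js] by simp
        with js True ce(2) show "js \<in> {js. js \<in> ?J \<and> insert i (set js) = e}" by auto
      qed
      have "(\<Sum>js | js \<in> ?J \<and> insert i (set js) = e. (\<Prod>j\<leftarrow>js. x j) / fact (k - 1)) =
          (\<Sum>js\<in>permutations_of_set (e - {i}). (\<Prod>j\<in>e - {i}. x j) / fact (k - 1))"
        unfolding eq
      proof (intro sum.cong refl)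
        fix js assume "js \<in> permutations_of_set (e - {i})"
        then have js: "set js = e - {i}" "distinct js" by (auto simp: permutations_of_set_def)
        show "(\<Prod>j\<leftarrow>js. x j) / fact (k - 1) = (\<Prod>j\<in>e - {i}. x j) / fact (k - 1)"
          using prod.distinct_set_conv_list[OF js(2), of x] js(1) by simp
      qed
      also have "\<dots> = (\<Prod>j\<in>e - {i}. x j)"
        using ci fe by (simp add: card_permutations_of_set)
      finally show ?thesis using True by simp
    next
      case False
      then have "{js. js \<in> ?J \<and> insert i (set js) = e} = {}" by auto
      then show ?thesis using False by (simp only: sum.empty if_False)
    qed
  qed
  also have "\<dots> = (\<Sum>e | e \<in> E \<and> i \<in> e. \<Prod>j\<in>e - {i}. x j)"
    using finE by (simp add: sum.inter_filter)
  finally show ?thesis .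
qed

lemma tensor_apply_degree_tensor:
  assumes "finite V" and k: "k > 0" and i: "i \<in> V"
  shows "tensor_apply k V (degree_tensor k E) x i = of_nat (vertex_degree E i) * x i ^ (k - 1)"
proof -
  let ?J = "{js. set js \<subseteq> V \<and> length js = k - 1}"
  let ?r = "replicate (k - 1) i"
  have finJ: "finite ?J" using assms by (intro finite_lists_length_eq)
  have "i # js = replicate k i \<longleftrightarrow> js = ?r" for js
    using k by (cases k) auto
  then have "tensor_apply k V (degree_tensor k E) x i =
      (\<Sum>js\<in>?J. if js = ?r then of_nat (vertex_degree E i) * (\<Prod>j\<leftarrow>?r. x j) else 0)"
    unfolding tensor_apply_def by (intro sum.cong) (auto simp: degree_tensor_def)
  also have "\<dots> = of_nat (vertex_degree E i) * (\<Prod>j\<leftarrow>?r. x j)"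
    using finJ i by (subst sum.delta) auto
  finally show ?thesis by (simp add: prod_list_replicate)
qed

lemma tensor_apply_A_alpha:
  assumes G: "uniform_hypergraph k V E" and "k > 0" and "i \<in> V"
  shows "tensor_apply k V (A_alpha k E \<alpha>) x i =
    of_real \<alpha> * of_nat (vertex_degree E i) * x i ^ (k - 1)
    + of_real (1 - \<alpha>) * (\<Sum>e | e \<in> E \<and> i \<in> e. \<Prod>j\<in>e - {i}. x j)"
proof -
  have "tensor_apply k V (A_alpha k E \<alpha>) x i =
      of_real \<alpha> * tensor_apply k V (degree_tensor k E) x i
      + of_real (1 - \<alpha>) * tensor_apply k V (adjacency_tensor k E) x i"
    by (simp add: tensor_apply_def A_alpha_def sum_distrib_left distrib_right sum.distrib mult.assoc)
  then show ?thesis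
    using assms tensor_apply_adjacency_tensor[OF assms] tensor_apply_degree_tensor[of V k i E x]
    by (simp add: uniform_hypergraph_def)
qed

section \<open>The form of the tensor and its maximum on the nonnegative unit sphere\<close>

text \<open>\<open>x\<^sup>T(A\<^sub>\<alpha>x)\<close>: the \<open>k!\<close> orderings of an edge and the entries \<open>1/(k - 1)!\<close> leave the factor \<open>k\<close>.\<close>

definition alpha_form :: "nat \<Rightarrow> 'a set \<Rightarrow> 'a set set \<Rightarrow> real \<Rightarrow> ('a \<Rightarrow> real) \<Rightarrow> real" where
  "alpha_form k V E \<alpha> x =
     \<alpha> * (\<Sum>i\<in>V. real (vertex_degree E i) * x i ^ k) + (1 - \<alpha>) * real k * (\<Sum>e\<in>E. \<Prod>i\<in>e. x i)"

lemma alpha_form_cong: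
  assumes "uniform_hypergraph k V E" "\<And>i. i \<in> V \<Longrightarrow> x i = y i"
  shows "alpha_form k V E \<alpha> x = alpha_form k V E \<alpha> y"
proof -
  have "(\<Prod>i\<in>e. x i) = (\<Prod>i\<in>e. y i)" if "e \<in> E" for e
    using assms that by (intro prod.cong) (auto simp: uniform_hypergraph_def)
  then show ?thesis
    using assms(2) by (simp add: alpha_form_def)
qed

lemma alpha_form_scale:
  assumes "uniform_hypergraph k V E"
  shows "alpha_form k V E \<alpha> (\<lambda>i. c * x i) = c ^ k * alpha_form k V E \<alpha> x"
proof -
  have "(\<Prod>i\<in>e. c * x i) = c ^ k * (\<Prod>i\<in>e. x i)" if "e \<in> E" for e
    using assms that by (simp add: prod.distrib uniform_hypergraph_def)
  then have "(\<Sum>e\<in>E. \<Prod>i\<in>e. c * x i) = c ^ k * (\<Sum>e\<in>E. \<Prod>i\<in>e. x i)"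
    by (simp add: sum_distrib_left)
  moreover have "(\<Sum>i\<in>V. real (vertex_degree E i) * (c * x i) ^ k) =
      c ^ k * (\<Sum>i\<in>V. real (vertex_degree E i) * x i ^ k)"
    by (simp add: power_mult_distrib sum_distrib_left mult.left_commute)
  ultimately show ?thesis
    by (simp add: alpha_form_def algebra_simps)
qed

lemma alpha_form_nonneg:
  assumes "uniform_hypergraph k V E" "0 \<le> \<alpha>" "\<alpha> \<le> 1" "\<And>i. i \<in> V \<Longrightarrow> x i \<ge> 0"
  shows "alpha_form k V E \<alpha> x \<ge> 0"
  unfolding alpha_form_def
  using assms
  by (intro add_nonneg_nonneg mult_nonneg_nonneg sum_nonneg prod_nonneg)
    (auto simp: uniform_hypergraph_def)

lemma continuous_on_alpha_form:
  "continuous_on UNIV (\<lambda>x :: 'a \<Rightarrow> real. alpha_form k V E \<alpha> x)"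
  unfolding alpha_form_def
  by (intro continuous_intros continuous_on_product_then_coordinatewise[OF continuous_on_id])

text \<open>An edge contains a vertex at most once, so in the single coordinate \<open>i\<close> the
  form is a multiple of \<open>u ^ k\<close> plus an affine function of \<open>u\<close>. This exact
  difference formula takes the place of a partial derivative.\<close>

lemma alpha_form_update:
  assumes G: "uniform_hypergraph k V E" and i: "i \<in> V"
  shows "alpha_form k V E \<alpha> (x(i := u)) - alpha_form k V E \<alpha> x =
    \<alpha> * real (vertex_degree E i) * (u ^ k - x i ^ k)
    + (1 - \<alpha>) * real k * (\<Sum>e | e \<in> E \<and> i \<in> e. \<Prod>j\<in>e - {i}. x j) * (u - x i)"
proof -
  have finV: "finite V" using G by (simp add: uniform_hypergraph_def)
  have finE: "finite E" by (rule uniform_hypergraph_finite_edges[OF G])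
  have "(\<Sum>j\<in>V. real (vertex_degree E j) * (x(i := u)) j ^ k) - (\<Sum>j\<in>V. real (vertex_degree E j) * x j ^ k)
      = (\<Sum>j\<in>V. if j = i then real (vertex_degree E i) * (u ^ k - x i ^ k) else 0)"
    unfolding sum_subtractf[symmetric] by (intro sum.cong) (auto simp: algebra_simps)
  then have 1: "(\<Sum>j\<in>V. real (vertex_degree E j) * (x(i := u)) j ^ k)
      - (\<Sum>j\<in>V. real (vertex_degree E j) * x j ^ k) = real (vertex_degree E i) * (u ^ k - x i ^ k)"
    using finV i by simp
  have "(\<Prod>j\<in>e. (x(i := u)) j) - (\<Prod>j\<in>e. x j) =
      (if i \<in> e then (\<Prod>j\<in>e - {i}. x j) * (u - x i) else 0)" if "e \<in> E" for e
  proof (cases "i \<in> e")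
    case True
    have fe: "finite e" by (rule uniform_hypergraph_finite_edge[OF G that])
    have "(\<Prod>j\<in>e - {i}. (x(i := u)) j) = (\<Prod>j\<in>e - {i}. x j)" by (intro prod.cong) auto
    then show ?thesis
      using True prod.remove[OF fe True, of "x(i := u)"] prod.remove[OF fe True, of x]
      by (simp add: algebra_simps)
  next
    case False
    then have "(\<Prod>j\<in>e. (x(i := u)) j) = (\<Prod>j\<in>e. x j)" by (intro prod.cong) auto
    with False show ?thesis by simp
  qed
  then have "(\<Sum>e\<in>E. \<Prod>j\<in>e. (x(i := u)) j) - (\<Sum>e\<in>E. \<Prod>j\<in>e. x j) =
      (\<Sum>e\<in>E. if i \<in> e then (\<Prod>j\<in>e - {i}. x j) * (u - x i) else 0)"
    unfolding sum_subtractf[symmetric] by (intro sum.cong refl)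
  also have "\<dots> = (\<Sum>e | e \<in> E \<and> i \<in> e. \<Prod>j\<in>e - {i}. x j) * (u - x i)"
    using finE by (simp flip: sum.inter_filter sum_distrib_right)
  finally have 2: "(\<Sum>e\<in>E. \<Prod>j\<in>e. (x(i := u)) j) - (\<Sum>e\<in>E. \<Prod>j\<in>e. x j) =
      (\<Sum>e | e \<in> E \<and> i \<in> e. \<Prod>j\<in>e - {i}. x j) * (u - x i)" .
  show ?thesis
    unfolding alpha_form_def
    by (simp only: mult.assoc flip: 1 2) (simp add: algebra_simps)
qed

text \<open>A continuous function attains its maximum on the compact unit sphere; homogeneity of
  degree \<open>k\<close> extends the bound from unit vectors to all nonnegative
  \<open>y\<close>.\<close>

lemma alpha_form_maximum:
  assumes G: "uniform_hypergraph k V E" and k: "k > 0" and V: "V \<noteq> {}"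
  obtains x where "\<And>i. x i \<ge> 0" "(\<Sum>i\<in>V. x i ^ k) = 1"
    "\<And>y. (\<And>i. i \<in> V \<Longrightarrow> y i \<ge> 0) \<Longrightarrow>
      alpha_form k V E \<alpha> y \<le> alpha_form k V E \<alpha> x * (\<Sum>i\<in>V. y i ^ k)"
proof -
  have finV: "finite V" using G by (simp add: uniform_hypergraph_def)
  \<comment> \<open>Vectors are functions on the whole type. Fixing the value 0 off \<open>V\<close>
    makes \<open>P\<close> a product of compact sets, to which Tychonoff's theorem applies.\<close>
  define P :: "('a \<Rightarrow> real) set" where
    "P = PiE UNIV (\<lambda>i. if i \<in> V then {0..1} else {0})"
  define K where "K = P \<inter> {x. (\<Sum>i\<in>V. x i ^ k) = 1}"
  have "compactin (product_topology (\<lambda>i::'a. euclidean :: real topology) UNIV) P"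
    unfolding P_def by (subst compactin_PiE) auto
  then have "compact P"
    by (simp add: euclidean_product_topology)
  moreover have "closed {x :: 'a \<Rightarrow> real. (\<Sum>i\<in>V. x i ^ k) = 1}"
    by (intro closed_Collect_eq continuous_intros
        continuous_on_product_then_coordinatewise[OF continuous_on_id])
  ultimately have cK: "compact K" unfolding K_def by (rule compact_Int_closed)
  have unit: "\<exists>y\<in>K. \<forall>i\<in>V. y i = x i"
    if x: "\<And>i. i \<in> V \<Longrightarrow> x i \<ge> 0" "(\<Sum>i\<in>V. x i ^ k) = 1" for x
  proof (intro bexI ballI)
    have "x i \<le> 1" if "i \<in> V" for i
    proof -
      have "x i ^ k \<le> (\<Sum>i\<in>V. x i ^ k)"
        using that finV x by (intro member_le_sum) auto
      then have "x i ^ k \<le> 1 ^ k" using x by simp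
      then show ?thesis using k by (simp add: power_le_one_iff that x)
    qed
    then show "(\<lambda>i. if i \<in> V then x i else 0) \<in> K"
      using x by (auto simp: K_def P_def)
  qed auto
  obtain i0 where i0: "i0 \<in> V" using V by blast
  have "(\<Sum>i\<in>V. (if i = i0 then 1 else 0 :: real) ^ k) = (\<Sum>i\<in>V. if i = i0 then 1 else 0)"
    using k by (intro sum.cong) auto
  then have "(\<Sum>i\<in>V. (if i = i0 then 1 else 0 :: real) ^ k) = 1"
    using i0 finV by simp
  from unit[OF _ this] have "K \<noteq> {}" by (metis empty_iff zero_le_one order_refl)
  then obtain x where x: "x \<in> K" "\<And>y. y \<in> K \<Longrightarrow> alpha_form k V E \<alpha> y \<le> alpha_form k V E \<alpha> x"
    using continuous_attains_sup[OF cK _ continuous_on_subset[OF continuous_on_alpha_form subset_UNIV]]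
    by metis
  show ?thesis
  proof (rule that[of x])
    show "x i \<ge> 0" for i
      using x(1) by (cases "i \<in> V") (auto simp: K_def P_def PiE_def Pi_def dest!: spec[of _ i])
    show "(\<Sum>i\<in>V. x i ^ k) = 1" using x(1) by (simp add: K_def)
    fix y :: "'a \<Rightarrow> real" assume y: "\<And>i. i \<in> V \<Longrightarrow> y i \<ge> 0"
    define N where "N = (\<Sum>i\<in>V. y i ^ k)"
    have "N \<ge> 0" unfolding N_def using y by (intro sum_nonneg) auto
    show "alpha_form k V E \<alpha> y \<le> alpha_form k V E \<alpha> x * (\<Sum>i\<in>V. y i ^ k)"
    proof (cases "N = 0")
      case True
      then have "\<forall>i\<in>V. y i ^ k = 0"
        unfolding N_def using y by (subst (asm) sum_nonneg_eq_0_iff[OF finV]) auto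
      \<comment> \<open>A vector vanishing on \<open>V\<close> cannot be normalised; writing it as 0
        times itself lets homogeneity give the value 0 of the form.\<close>
      then have "\<And>i. i \<in> V \<Longrightarrow> y i = 0 * y i" by auto
      then have "alpha_form k V E \<alpha> y = alpha_form k V E \<alpha> (\<lambda>i. 0 * y i)"
        by (rule alpha_form_cong[OF G])
      then have "alpha_form k V E \<alpha> y = 0"
        using k unfolding alpha_form_scale[OF G] by (simp add: power_0_left)
      then show ?thesis using True by (simp add: N_def)
    next
      case False
      with \<open>N \<ge> 0\<close> have N: "N > 0" by simp
      define c where "c = 1 / root k N"
      have c: "c ^ k = 1 / N" "c \<ge> 0" using N k by (auto simp: c_def power_divide)
      have "(\<Sum>i\<in>V. (c * y i) ^ k) = 1"
        unfolding power_mult_distrib sum_distrib_left[symmetric] N_def[symmetric] using N c by simp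
      then obtain w where w: "w \<in> K" "\<forall>i\<in>V. w i = c * y i"
        using unit[of "\<lambda>i. c * y i"] y c(2) by auto
      have "c ^ k * alpha_form k V E \<alpha> y = alpha_form k V E \<alpha> w"
        unfolding alpha_form_scale[OF G, symmetric] by (rule alpha_form_cong[OF G]) (simp add: w)
      also have "\<dots> \<le> alpha_form k V E \<alpha> x" by (rule x(2)[OF w(1)])
      finally show ?thesis using N c by (simp add: field_simps flip: N_def)
    qed
  qed
qed

section \<open>Connectedness and positivity of a maximiser\<close>

text \<open>A walk from inside \<open>P\<close> to outside has a step that leaves \<open>P\<close>,
  and the edge used there crosses the boundary.\<close>

lemma hypergraph_connected_crossing_edge:
  assumes "hypergraph_connected V E" "u \<in> V" "v \<in> V" "u \<in> P" "v \<notin> P"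
  obtains e where "e \<in> E" "e \<inter> P \<noteq> {}" "\<not> e \<subseteq> P"
proof -
  obtain vs es where w: "length vs = Suc (length es)" "hd vs = u" "last vs = v"
    "\<And>t. t < length es \<Longrightarrow> es ! t \<in> E \<and> {vs ! t, vs ! Suc t} \<subseteq> es ! t"
    using assms(1-3) unfolding hypergraph_connected_def by metis
  have "\<exists>t<length es. vs ! t \<in> P \<and> vs ! Suc t \<notin> P"
  proof (rule ccontr)
    assume neg: "\<not> ?thesis"
    have "t \<le> length es \<Longrightarrow> vs ! t \<in> P" for t
    proof (induction t)
      case 0
      then show ?case using w(1,2) assms(4) by (cases vs) auto
    next
      case (Suc t)
      then show ?case using neg by auto
    qed
    then have "vs ! (length vs - 1) \<in> P" using w(1) by simp
    then have "last vs \<in> P" using w(1) last_conv_nth[of vs] by fastforce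
    with w(3) assms(5) show False by simp
  qed
  then obtain t where t: "t < length es" "vs ! t \<in> P" "vs ! Suc t \<notin> P" by blast
  then show ?thesis using w(4)[OF t(1)] by (intro that[of "es ! t"]) auto
qed

text \<open>Raising the zero entries of a maximiser to \<open>t\<close> costs \<open>O(t\<^sup>k)\<close> in the constraint, but an edge
  with \<open>r\<close> zero and some nonzero entries gains order \<open>t\<^sup>r\<close> with \<open>r < k\<close>.\<close>

lemma alpha_form_maximiser_pos:
  assumes G: "uniform_hypergraph k V E" and conn: "hypergraph_connected V E"
    and k: "k > 0" and \<alpha>: "0 \<le> \<alpha>" "\<alpha> < 1"
    and x: "\<And>i. x i \<ge> 0" "(\<Sum>i\<in>V. x i ^ k) = 1"
    and max: "\<And>y. (\<And>i. i \<in> V \<Longrightarrow> y i \<ge> 0) \<Longrightarrow>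
      alpha_form k V E \<alpha> y \<le> alpha_form k V E \<alpha> x * (\<Sum>i\<in>V. y i ^ k)"
    and v: "v \<in> V"
  shows "x v > 0"
proof (rule ccontr)
  assume "\<not> x v > 0"
  have finV: "finite V" using G by (simp add: uniform_hypergraph_def)
  have finE: "finite E" by (rule uniform_hypergraph_finite_edges[OF G])
  define P where "P = {i. x i > 0}"
  have vP: "v \<notin> P" using \<open>\<not> x v > 0\<close> by (simp add: P_def)
  have "\<exists>u\<in>V. u \<in> P"
  proof (rule ccontr)
    assume "\<not> ?thesis"
    then have "(\<Sum>i\<in>V. x i ^ k) = 0"
      using k x(1) by (intro sum.neutral) (force simp: P_def not_less intro: antisym)
    with x(2) show False by simp
  qed
  then obtain u where "u \<in> V" "u \<in> P" by blast
  then obtain e where e: "e \<in> E" "e \<inter> P \<noteq> {}" "\<not> e \<subseteq> P"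
    using hypergraph_connected_crossing_edge[OF conn _ v _ vP] by metis
  have fe: "finite e" by (rule uniform_hypergraph_finite_edge[OF G e(1)])
  have ce: "card e = k" using G e(1) by (auto simp: uniform_hypergraph_def)
  define \<mu> where "\<mu> = alpha_form k V E \<alpha> x"
  define c where "c = (\<Prod>i\<in>e \<inter> P. x i)"
  define q where "q = real (card (V - P))"
  define r where "r = card (e - P)"
  have r: "r \<le> k - 1"
  proof -
    have *: "e - P \<subset> e" using e(2) by auto
    show ?thesis using psubset_card_mono[OF fe *] ce by (simp add: r_def)
  qed
  have c: "c > 0" unfolding c_def by (intro prod_pos) (auto simp: P_def)
  have \<mu>: "\<mu> \<ge> 0" unfolding \<mu>_def using \<alpha> x by (intro alpha_form_nonneg[OF G]) auto
  \<comment> \<open>The left side is a fixed positive number, whereas the right side tends to 0 with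
    \<open>t\<close>; this is the contradiction drawn at the end.\<close>
  have bound: "(1 - \<alpha>) * real k * c \<le> \<mu> * q * t" if t: "0 < t" "t \<le> 1" for t
  proof -
    define y where "y i = (if i \<in> P then x i else t)" for i
    have xP: "x i = 0" if "i \<notin> P" for i using that x(1)[of i] by (auto simp: P_def)
    have xy: "x i \<le> y i" for i using xP[of i] t by (auto simp: y_def)
    have y: "y i \<ge> 0" for i using xy[of i] x(1)[of i] by linarith
    have "(\<Sum>i\<in>V. y i ^ k) = (\<Sum>i\<in>V. x i ^ k + (if i \<in> V - P then t ^ k else 0))"
      using k xP by (intro sum.cong) (auto simp: y_def)
    also have "\<dots> = 1 + q * t ^ k"
      unfolding sum.distrib sum.inter_restrict[OF finV, symmetric]
      by (simp add: x(2) q_def Int_absorb1 Diff_subset)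
    finally have Ny: "(\<Sum>i\<in>V. y i ^ k) = 1 + q * t ^ k" .
    \<comment> \<open>The crossing edge \<open>e\<close> contributes 0 at \<open>x\<close> and
      \<open>c * t ^ r\<close> at \<open>y\<close>. No other edge loses, because
      \<open>x \<le> y\<close> pointwise.\<close>
    have "(\<Prod>i\<in>e. x i) = 0" using e(3) fe xP by auto
    moreover have "(\<Prod>i\<in>e. y i) = c * t ^ r"
    proof -
      have "(\<Prod>i\<in>e. y i) = (\<Prod>i\<in>e \<inter> P. y i) * (\<Prod>i\<in>e - P. y i)"
        using prod.Int_Diff[OF fe] by blast
      also have "(\<Prod>i\<in>e \<inter> P. y i) = c" unfolding c_def by (intro prod.cong) (auto simp: y_def)
      also have "(\<Prod>i\<in>e - P. y i) = (\<Prod>i\<in>e - P. t)" by (intro prod.cong) (auto simp: y_def)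
      finally show ?thesis by (simp add: r_def)
    qed
    ultimately have "(\<Sum>f\<in>E. \<Prod>i\<in>f. x i) + c * t ^ r \<le> (\<Sum>f\<in>E. \<Prod>i\<in>f. y i)"
      using sum.remove[OF finE e(1), of "\<lambda>f. \<Prod>i\<in>f. x i"]
        sum.remove[OF finE e(1), of "\<lambda>f. \<Prod>i\<in>f. y i"]
        sum_mono[of "E - {e}" "\<lambda>f. \<Prod>i\<in>f. x i" "\<lambda>f. \<Prod>i\<in>f. y i"] prod_mono[of _ x y] x(1) xy
      by force
    then have "(1 - \<alpha>) * real k * ((\<Sum>f\<in>E. \<Prod>i\<in>f. x i) + c * t ^ r)
        \<le> (1 - \<alpha>) * real k * (\<Sum>f\<in>E. \<Prod>i\<in>f. y i)"
      using \<alpha> by (intro mult_left_mono) auto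
    moreover have "\<alpha> * (\<Sum>i\<in>V. real (vertex_degree E i) * x i ^ k)
        \<le> \<alpha> * (\<Sum>i\<in>V. real (vertex_degree E i) * y i ^ k)"
      using \<alpha> x(1) xy by (intro mult_left_mono sum_mono power_mono) auto
    ultimately have "\<mu> + (1 - \<alpha>) * real k * c * t ^ r \<le> alpha_form k V E \<alpha> y"
      unfolding \<mu>_def alpha_form_def by (simp add: algebra_simps)
    also have "\<dots> \<le> \<mu> * (1 + q * t ^ k)"
      unfolding \<mu>_def Ny[symmetric] by (rule max) (rule y)
    finally have "(1 - \<alpha>) * real k * c * t ^ r \<le> \<mu> * q * t ^ k" by (simp add: algebra_simps)
    \<comment> \<open>Here \<open>t \<le> 1\<close> and \<open>r \<le> k - 1\<close> enter; the
      common factor \<open>t ^ (k - 1)\<close> can then be cancelled.\<close>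
    moreover have "(1 - \<alpha>) * real k * c * t ^ (k - 1) \<le> (1 - \<alpha>) * real k * c * t ^ r"
      using \<alpha> c t r by (intro mult_left_mono power_decreasing) auto
    ultimately have "(1 - \<alpha>) * real k * c * t ^ (k - 1) \<le> (\<mu> * q * t) * t ^ (k - 1)"
      using k by (simp add: power_eq_if mult.assoc)
    then show ?thesis using t by simp
  qed
  have "\<forall>\<^sub>F t in at_right 0. (1 - \<alpha>) * real k * c \<le> \<mu> * q * t"
    by (rule eventually_at_rightI[of 0 1]) (use bound in auto)
  moreover have "((\<lambda>t::real. \<mu> * q * t) \<longlongrightarrow> \<mu> * q * 0) (at_right 0)"
    by (intro tendsto_intros)
  ultimately have "(1 - \<alpha>) * real k * c \<le> \<mu> * q * 0"
    by (intro tendsto_lowerbound) auto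
  moreover have "(1 - \<alpha>) * real k * c > 0" using \<alpha> k c by simp
  ultimately show False by simp
qed

section \<open>The positive eigenvector\<close>

text \<open>The first-order condition. As \<open>t > 0\<close>, a minimum over
  \<open>u \<ge> 0\<close> is a two-sided local minimum, so the derivative vanishes.\<close>

lemma min_power_minus_linear:
  fixes a b t :: real
  assumes t: "t > 0" and k: "k > 0"
    and min: "\<And>u. u \<ge> 0 \<Longrightarrow> a * t ^ k - real k * b * t \<le> a * u ^ k - real k * b * u"
  shows "a * t ^ (k - 1) = b"
proof -
  let ?h = "\<lambda>u. a * u ^ k - real k * b * u"
  have "(?h has_real_derivative a * (real k * t ^ (k - 1)) - real k * b) (at t)"
    by (auto intro!: derivative_eq_intros)
  then have "a * (real k * t ^ (k - 1)) - real k * b = 0"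
    by (rule DERIV_local_min[where d = t]) (use t in \<open>auto intro!: min\<close>)
  then have "real k * (a * t ^ (k - 1) - b) = 0" by (simp add: algebra_simps)
  then show ?thesis using k by simp
qed

text \<open>The maximal value of the form is the eigenvalue \<open>\<mu>\<close>: the eigenvalue
  equation is the Lagrange condition, obtained one coordinate at a time. As an eigenvalue,
  \<open>\<mu>\<close> is bounded by the spectral radius.\<close>

lemma A_alpha_positive_eigenvector:
  assumes G: "uniform_hypergraph k V E" and conn: "hypergraph_connected V E"
    and k: "k > 0" and V: "V \<noteq> {}" and \<alpha>: "0 \<le> \<alpha>" "\<alpha> < 1"
  obtains \<mu> x where "\<And>i. i \<in> V \<Longrightarrow> x i > 0" "0 \<le> \<mu>" "\<mu> \<le> rho_alpha k V E \<alpha>"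
    "\<And>i. i \<in> V \<Longrightarrow> (1 - \<alpha>) * (\<Sum>e | e \<in> E \<and> i \<in> e. \<Prod>j\<in>e - {i}. x j) =
      (\<mu> - \<alpha> * real (vertex_degree E i)) * x i ^ (k - 1)"
proof -
  have finV: "finite V" using G by (simp add: uniform_hypergraph_def)
  obtain x where x: "\<And>i. x i \<ge> 0" "(\<Sum>i\<in>V. x i ^ k) = 1"
    and max: "\<And>y. (\<And>i. i \<in> V \<Longrightarrow> y i \<ge> 0) \<Longrightarrow>
      alpha_form k V E \<alpha> y \<le> alpha_form k V E \<alpha> x * (\<Sum>i\<in>V. y i ^ k)"
    using alpha_form_maximum[OF G k V, of \<alpha> thesis] by auto
  note pos = alpha_form_maximiser_pos[OF G conn k \<alpha> x max]
  define \<mu> where "\<mu> = alpha_form k V E \<alpha> x"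
  define p where "p i = (\<Sum>e | e \<in> E \<and> i \<in> e. \<Prod>j\<in>e - {i}. x j)" for i
  have \<mu>: "\<mu> \<ge> 0" unfolding \<mu>_def using \<alpha> x by (intro alpha_form_nonneg[OF G]) auto
  \<comment> \<open>Maximality against \<open>x(i := u)\<close> says that \<open>u = x i\<close>
    minimises a multiple of \<open>u ^ k\<close> minus a linear term. Positivity of
    \<open>x i\<close> makes this an interior minimum.\<close>
  have eigen: "(\<mu> - \<alpha> * real (vertex_degree E i)) * x i ^ (k - 1) = (1 - \<alpha>) * p i" if i: "i \<in> V" for i
  proof (rule min_power_minus_linear[OF pos[OF _ i] k])
    fix u :: real assume u: "u \<ge> 0"
    have "(\<Sum>j\<in>V. (x(i := u)) j ^ k) - (\<Sum>j\<in>V. x j ^ k) = (\<Sum>j\<in>V. if j = i then u ^ k - x i ^ k else 0)"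
      unfolding sum_subtractf[symmetric] by (intro sum.cong) auto
    then have "(\<Sum>j\<in>V. (x(i := u)) j ^ k) = 1 + (u ^ k - x i ^ k)"
      using x(2) finV i by simp
    then have "alpha_form k V E \<alpha> (x(i := u)) \<le> \<mu> * (1 + (u ^ k - x i ^ k))"
      using max[of "x(i := u)"] u x(1) by (simp add: \<mu>_def)
    then show "(\<mu> - \<alpha> * real (vertex_degree E i)) * x i ^ k - real k * ((1 - \<alpha>) * p i) * x i
        \<le> (\<mu> - \<alpha> * real (vertex_degree E i)) * u ^ k - real k * ((1 - \<alpha>) * p i) * u"
      using alpha_form_update[OF G i, of \<alpha> x u]
      by (simp add: algebra_simps flip: p_def \<mu>_def)
  qed auto
  have "tensor_eigenpair k V (A_alpha k E \<alpha>) (of_real \<mu>) (\<lambda>i. of_real (x i))"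
    unfolding tensor_eigenpair_def
  proof (intro conjI ballI)
    show "\<exists>i\<in>V. complex_of_real (x i) \<noteq> 0"
      using V pos by fastforce
    fix i assume i: "i \<in> V"
    have "tensor_apply k V (A_alpha k E \<alpha>) (\<lambda>i. of_real (x i)) i =
        of_real (\<alpha> * real (vertex_degree E i) * x i ^ (k - 1) + (1 - \<alpha>) * p i)"
      using k by (subst tensor_apply_A_alpha[OF G _ i]) (auto simp: p_def)
    also have "\<alpha> * real (vertex_degree E i) * x i ^ (k - 1) + (1 - \<alpha>) * p i = \<mu> * x i ^ (k - 1)"
      using eigen[OF i] by (simp add: algebra_simps)
    finally show "tensor_apply k V (A_alpha k E \<alpha>) (\<lambda>i. of_real (x i)) i =
        of_real \<mu> * complex_of_real (x i) ^ (k - 1)"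
      by simp
  qed
  then have "cmod (of_real \<mu>) \<le> rho_alpha k V E \<alpha>"
    unfolding rho_alpha_def
    by (intro tensor_spectral_radius_upper[OF finV]) (auto simp: tensor_eigenvalues_def)
  then have "\<mu> \<le> rho_alpha k V E \<alpha>" by simp
  then show ?thesis
    using pos \<mu> eigen by (intro that[of x \<mu>]) (auto simp: p_def)
qed

lemma rho_alpha_nonneg:
  assumes "uniform_hypergraph k V E" "hypergraph_connected V E" "k > 0" "V \<noteq> {}" "0 \<le> \<alpha>" "\<alpha> < 1"
  shows "rho_alpha k V E \<alpha> \<ge> 0"
  by (rule A_alpha_positive_eigenvector[OF assms]) linarith

section \<open>The lower bound for the spectral radius from a nonnegative test vector\<close>

text \<open>AM-GM for the powers \<open>a i ^ card A\<close>, whose geometric mean is the plain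
  product.\<close>

lemma prod_le_mean_power:
  fixes a :: "'a \<Rightarrow> real"
  assumes "finite A" "A \<noteq> {}" "\<And>i. i \<in> A \<Longrightarrow> a i \<ge> 0"
  shows "(\<Prod>i\<in>A. a i) \<le> (\<Sum>i\<in>A. a i ^ card A) / real (card A)"
proof -
  have "card A > 0" using assms by (simp add: card_gt_0_iff)
  then have "(\<Prod>i\<in>A. a i ^ card A) = (\<Prod>i\<in>A. a i) powr real (card A)"
    using assms(3) by (simp add: prod_nonneg powr_realpow' prod_power_distrib)
  then have "(\<Prod>i\<in>A. a i) = (\<Prod>i\<in>A. a i ^ card A) powr (1 / real (card A))"
    using assms(3) \<open>card A > 0\<close> by (simp add: prod_nonneg powr_powr)
  also have "\<dots> \<le> (\<Sum>i\<in>A. a i ^ card A / real (card A))"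
    using assms by (intro arith_geom_mean) auto
  finally show ?thesis by (simp add: sum_divide_distrib)
qed

text \<open>For a positive eigenvector \<open>x\<close> and a vertex \<open>i\<close> of an edge \<open>e\<close>, apply AM-GM to the factors
  \<open>y\<^sub>i / x\<^sub>i\<close> and \<open>1 / x\<^sub>j\<close> (\<open>j \<noteq> i\<close>) of \<open>y\<^sub>i / \<Prod>\<^sub>e x\<close>. In the sum over all edges, the eigenvalue
  equation eliminates \<open>x\<close>.\<close>

lemma rho_alpha_ge_linear:
  assumes G: "uniform_hypergraph k V E" and conn: "hypergraph_connected V E"
    and k: "k > 0" and V: "V \<noteq> {}" and \<alpha>: "0 \<le> \<alpha>" "\<alpha> < 1"
    and y: "\<And>i. i \<in> V \<Longrightarrow> y i \<ge> 0"
  shows "\<alpha> * (\<Sum>i\<in>V. real (vertex_degree E i) * ((y i ^ k + (real k - 1)) / real k))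
      + (1 - \<alpha>) * (\<Sum>i\<in>V. real (vertex_degree E i) * y i)
    \<le> rho_alpha k V E \<alpha> * (\<Sum>i\<in>V. (y i ^ k + (real k - 1)) / real k)"
proof -
  obtain \<mu> x where x: "\<And>i. i \<in> V \<Longrightarrow> x i > 0" and \<mu>: "0 \<le> \<mu>" "\<mu> \<le> rho_alpha k V E \<alpha>"
    and eigen: "\<And>i. i \<in> V \<Longrightarrow> (1 - \<alpha>) * (\<Sum>e | e \<in> E \<and> i \<in> e. \<Prod>j\<in>e - {i}. x j) =
      (\<mu> - \<alpha> * real (vertex_degree E i)) * x i ^ (k - 1)"
    using A_alpha_positive_eigenvector[OF G conn k V \<alpha>, of thesis] by blast
  have finV: "finite V" using G by (simp add: uniform_hypergraph_def)
  have finE: "finite E" by (rule uniform_hypergraph_finite_edges[OF G])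
  \<comment> \<open>The mean of \<open>y i ^ k\<close> and \<open>k - 1\<close> ones: the total that
    AM-GM attaches to vertex \<open>i\<close> within one edge.\<close>
  define w where "w i = (y i ^ k + (real k - 1)) / real k" for i
  have edge: "(\<Sum>i\<in>e. y i) \<le> (\<Sum>i\<in>e. w i / x i ^ k * (\<Prod>j\<in>e. x j))" if e: "e \<in> E" for e
  proof -
    have fe: "finite e" by (rule uniform_hypergraph_finite_edge[OF G e])
    have ce: "card e = k" "e \<subseteq> V" using G e by (auto simp: uniform_hypergraph_def)
    have ne: "e \<noteq> {}" using ce k by auto
    let ?X = "\<Prod>j\<in>e. x j"
    have X: "?X > 0" using x ce by (intro prod_pos) auto
    have "y i \<le> (\<Sum>j\<in>e. ((if j = i then y i else 1) / x j) ^ k) / real k * ?X" if i: "i \<in> e" for i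
    proof -
      have "(\<Prod>j\<in>e. if j = i then y i else 1) = y i" using fe i by simp
      then have "y i = (\<Prod>j\<in>e. (if j = i then y i else 1) / x j) * ?X"
        using X by (simp add: prod_dividef)
      also have "\<dots> \<le> (\<Sum>j\<in>e. ((if j = i then y i else 1) / x j) ^ card e) / real (card e) * ?X"
        using X i y x ce(2) by (intro mult_right_mono prod_le_mean_power fe ne) (force intro!: divide_nonneg_pos)+
      finally show ?thesis by (simp add: ce)
    qed
    then have "(\<Sum>i\<in>e. y i) \<le> (\<Sum>i\<in>e. (\<Sum>j\<in>e. ((if j = i then y i else 1) / x j) ^ k) / real k * ?X)"
      by (rule sum_mono)
    also have "\<dots> = (\<Sum>i\<in>e. \<Sum>j\<in>e. ((if j = i then y i else 1) / x j) ^ k) / real k * ?X"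
      by (simp add: sum_distrib_right sum_divide_distrib)
    also have "(\<Sum>i\<in>e. \<Sum>j\<in>e. ((if j = i then y i else 1) / x j) ^ k) =
        (\<Sum>j\<in>e. \<Sum>i\<in>e. ((if j = i then y i else 1) / x j) ^ k)"
      by (rule sum.swap)
    \<comment> \<open>For fixed \<open>j\<close>, the term \<open>i = j\<close> supplies
      \<open>y j ^ k\<close> and each of the other \<open>k - 1\<close> vertices of \<open>e\<close>
      supplies 1.\<close>
    also have "\<dots> = (\<Sum>j\<in>e. real k * w j / x j ^ k)"
    proof (intro sum.cong refl)
      fix j assume j: "j \<in> e"
      have "(\<Sum>i\<in>e - {j}. ((if j = i then y i else 1) / x j) ^ k) = (\<Sum>i\<in>e - {j}. 1 / x j ^ k)"
        by (intro sum.cong) (auto simp: power_divide)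
      also have "\<dots> = (real k - 1) / x j ^ k" using j ce fe k by (simp add: of_nat_diff)
      finally have "(\<Sum>i\<in>e - {j}. ((if j = i then y i else 1) / x j) ^ k) = (real k - 1) / x j ^ k" .
      moreover have "real k * w j = y j ^ k + (real k - 1)" using k by (simp add: w_def)
      ultimately show "(\<Sum>i\<in>e. ((if j = i then y i else 1) / x j) ^ k) = real k * w j / x j ^ k"
        by (subst sum.remove[OF fe j]) (simp add: power_divide add_divide_distrib)
    qed
    also have "(\<Sum>j\<in>e. real k * w j / x j ^ k) / real k = (\<Sum>j\<in>e. w j / x j ^ k)"
      using k by (simp add: sum_divide_distrib)
    finally show ?thesis by (simp only: sum_distrib_right)
  qed
  have "(\<Sum>i\<in>V. real (vertex_degree E i) * y i) = (\<Sum>e\<in>E. \<Sum>i\<in>e. y i)"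
    by (rule sum_edges_sum_vertices[OF G, symmetric])
  also have "\<dots> \<le> (\<Sum>e\<in>E. \<Sum>i\<in>e. w i / x i ^ k * (\<Prod>j\<in>e. x j))"
    by (rule sum_mono) (rule edge)
  also have "\<dots> = (\<Sum>e\<in>E. \<Sum>i | i \<in> V \<and> i \<in> e. w i / x i ^ k * (\<Prod>j\<in>e. x j))"
    using G by (intro sum.cong refl) (auto simp: uniform_hypergraph_def)
  also have "\<dots> = (\<Sum>i\<in>V. \<Sum>e | e \<in> E \<and> i \<in> e. w i / x i ^ k * (\<Prod>j\<in>e. x j))"
    by (rule sum.swap_restrict[OF finE finV])
  \<comment> \<open>One factor \<open>x i\<close> of the edge product cancels against
    \<open>x i ^ k\<close>, which leaves the sum occurring in the eigenvalue equation.\<close>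
  also have "\<dots> = (\<Sum>i\<in>V. w i / x i ^ (k - 1) * (\<Sum>e | e \<in> E \<and> i \<in> e. \<Prod>j\<in>e - {i}. x j))"
  proof (intro sum.cong refl)
    fix i assume i: "i \<in> V"
    have "w i / x i ^ k * (\<Prod>j\<in>e. x j) = w i / x i ^ (k - 1) * (\<Prod>j\<in>e - {i}. x j)"
      if "e \<in> E" "i \<in> e" for e
      using prod.remove[OF uniform_hypergraph_finite_edge[OF G that(1)] that(2), of x] x[OF i] k
      by (simp add: power_eq_if)
    then show "(\<Sum>e | e \<in> E \<and> i \<in> e. w i / x i ^ k * (\<Prod>j\<in>e. x j)) =
        w i / x i ^ (k - 1) * (\<Sum>e | e \<in> E \<and> i \<in> e. \<Prod>j\<in>e - {i}. x j)"
      by (simp add: sum_distrib_left)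
  qed
  finally have "(1 - \<alpha>) * (\<Sum>i\<in>V. real (vertex_degree E i) * y i) \<le>
      (1 - \<alpha>) * (\<Sum>i\<in>V. w i / x i ^ (k - 1) * (\<Sum>e | e \<in> E \<and> i \<in> e. \<Prod>j\<in>e - {i}. x j))"
    using \<alpha> by (intro mult_left_mono) auto
  also have "\<dots> = (\<Sum>i\<in>V. (\<mu> - \<alpha> * real (vertex_degree E i)) * w i)"
    unfolding sum_distrib_left[of "1 - \<alpha>" _ V]
  proof (intro sum.cong refl)
    fix i assume i: "i \<in> V"
    have "(1 - \<alpha>) * (w i / x i ^ (k - 1) * (\<Sum>e | e \<in> E \<and> i \<in> e. \<Prod>j\<in>e - {i}. x j)) =
        w i / x i ^ (k - 1) * ((1 - \<alpha>) * (\<Sum>e | e \<in> E \<and> i \<in> e. \<Prod>j\<in>e - {i}. x j))"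
      by simp
    also have "\<dots> = (\<mu> - \<alpha> * real (vertex_degree E i)) * w i"
      unfolding eigen[OF i] using x[OF i] by simp
    finally show "(1 - \<alpha>) * (w i / x i ^ (k - 1) * (\<Sum>e | e \<in> E \<and> i \<in> e. \<Prod>j\<in>e - {i}. x j)) =
        (\<mu> - \<alpha> * real (vertex_degree E i)) * w i" .
  qed
  also have "\<dots> = \<mu> * (\<Sum>i\<in>V. w i) - \<alpha> * (\<Sum>i\<in>V. real (vertex_degree E i) * w i)"
    by (simp add: sum_subtractf sum_distrib_left left_diff_distrib mult.assoc)
  \<comment> \<open>The sum of the \<open>w i\<close> is nonnegative, so \<open>\<mu>\<close> may be
    replaced by the larger spectral radius.\<close>
  also have "\<mu> * (\<Sum>i\<in>V. w i) \<le> rho_alpha k V E \<alpha> * (\<Sum>i\<in>V. w i)"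
    unfolding w_def using \<mu> k y by (intro mult_right_mono sum_nonneg divide_nonneg_nonneg add_nonneg_nonneg) auto
  finally show ?thesis unfolding w_def by simp
qed

section \<open>The convexity estimate and the equality case of Hoelder's inequality\<close>

text \<open>Convexity of the \<open>k\<close>-th power at the points 1 and \<open>y\<close>, with
  weights \<open>1 - 1 / k\<close> and \<open>1 / k\<close>.\<close>

lemma shifted_power_mean:
  fixes y :: real
  assumes k: "k > 0" and y: "y \<ge> 0"
  shows "((y + real k - 1) / real k) ^ k \<le> (y ^ k + (real k - 1)) / real k"
proof -
  have "convex_on {0..} (\<lambda>x::real. x ^ k)"
    using convex_power_even[of k] convex_power_odd[of k] convex_on_subset by blast
  then have "((1 - 1 / real k) *\<^sub>R 1 + (1 / real k) *\<^sub>R y) ^ k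
      \<le> (1 - 1 / real k) * 1 ^ k + 1 / real k * y ^ k"
    by (rule convex_onD) (use k y in \<open>auto simp: divide_simps\<close>)
  then show ?thesis using k by (simp add: field_simps)
qed

text \<open>The weights are proportional to \<open>d i powr (1 / (k - 1))\<close>, so each summand
  is a constant multiple of a summand of \<open>D\<close>. If \<open>D = 0\<close>, both sides are
  0, division by zero being 0.\<close>

lemma Hoelder_equality_weights:
  fixes d :: "'a \<Rightarrow> real"
  assumes k: "k \<ge> 2" and d: "\<And>i. i \<in> S \<Longrightarrow> d i \<ge> 0" and s: "s \<ge> 0"
  defines "D \<equiv> (\<Sum>j\<in>S. d j powr (real k / (real k - 1)))"
  shows "(\<Sum>i\<in>S. d i * root k (s * d i powr (real k / (real k - 1)) / D)) =
    s powr (1 / real k) * D powr ((real k - 1) / real k)"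
proof -
  have D: "D \<ge> 0" unfolding D_def by (intro sum_nonneg) auto
  have root: "root k z = z powr (1 / real k)" if "z \<ge> 0" for z
    using that k by (cases "z = 0") (simp_all add: root_powr_inverse)
  have "d i * root k (s * d i powr (real k / (real k - 1)) / D) =
      s powr (1 / real k) / D powr (1 / real k) * d i powr (real k / (real k - 1))" if i: "i \<in> S" for i
  proof -
    have e: "real k / (real k - 1) * (1 / real k) = 1 / (real k - 1)"
      "1 + 1 / (real k - 1) = real k / (real k - 1)"
      using k by (auto simp: field_simps)
    have "d i * d i powr (1 / (real k - 1)) = d i powr (real k / (real k - 1))"
      using powr_mult_base[OF d[OF i], of "1 / (real k - 1)"] e(2) by simp
    moreover have "root k (s * d i powr (real k / (real k - 1)) / D) =
        s powr (1 / real k) * d i powr (1 / (real k - 1)) / D powr (1 / real k)"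
      using D s by (simp only: root powr_mult powr_divide powr_powr e powr_ge_zero
          mult_nonneg_nonneg divide_nonneg_nonneg)
    ultimately show ?thesis by (simp add: algebra_simps)
  qed
  then have "(\<Sum>i\<in>S. d i * root k (s * d i powr (real k / (real k - 1)) / D)) =
      s powr (1 / real k) / D powr (1 / real k) * D"
    by (simp add: D_def sum_distrib_left)
  also have "D / D powr (1 / real k) = D powr (1 - 1 / real k)"
    using D by (simp add: powr_diff)
  then have "s powr (1 / real k) / D powr (1 / real k) * D = s powr (1 / real k) * D powr (1 - 1 / real k)"
    by (metis times_divide_eq_left times_divide_eq_right)
  also have "1 - 1 / real k = (real k - 1) / real k" using k by (simp add: field_simps)
  finally show ?thesis .
qed

section \<open>The test vector and the final estimate\<close>

theorem theorem4p20:
  fixes k n m s :: nat and \<alpha> :: real and V S :: "'a set" and E :: "'a set set"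
  assumes "k \<ge> 3" and "0 \<le> \<alpha>" and "\<alpha> < 1"
    and "uniform_hypergraph k V E" and "hypergraph_connected V E"
    and "n = card V" and "m = card E"
    and "S \<subseteq> V" and "S \<noteq> {}" and "s = card S"
  shows "rho_alpha k V E \<alpha> - real k * real m / real n \<ge>
    \<alpha> / (real k ^ k * real n) *
      (\<Sum>i\<in>S. real (vertex_degree E i) *
        ((root k (real s * real (vertex_degree E i) powr (real k / (real k - 1)) /
                  (\<Sum>j\<in>S. real (vertex_degree E j) powr (real k / (real k - 1))))
          + real k - 1) ^ k - real k ^ k))
    + (1 - \<alpha>) / real n *
      (real s powr (1 / real k) *
        (\<Sum>i\<in>S. real (vertex_degree E i) powr (real k / (real k - 1))) powr ((real k - 1) / real k)
       - (\<Sum>i\<in>S. real (vertex_degree E i)))"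
proof -
  let ?d = "\<lambda>i. real (vertex_degree E i)"
  let ?q = "real k / (real k - 1)"
  define D where "D = (\<Sum>j\<in>S. ?d j powr ?q)"
  \<comment> \<open>The scaling makes the \<open>k\<close>-th powers over \<open>S\<close> sum to
    \<open>s\<close> when \<open>D > 0\<close>, so over \<open>V\<close> they sum to
    \<open>n\<close>.\<close>
  define y where "y i = (if i \<in> S then root k (real s * ?d i powr ?q / D) else 1)" for i
  define z where "z i = (y i + real k - 1) / real k" for i
  have k: "k > 0" using assms(1) by simp
  have G: "uniform_hypergraph k V E" by fact
  have finV: "finite V" using G by (simp add: uniform_hypergraph_def)
  have V: "V \<noteq> {}" using assms(8,9) by auto
  have finS: "finite S" using finV assms(8) by (rule finite_subset[rotated])
  have n: "real n > 0" using V finV assms(6) by (simp add: card_gt_0_iff)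
  have D: "D \<ge> 0" unfolding D_def by (intro sum_nonneg) auto
  have y: "y i \<ge> 0" for i
    using D by (auto simp: y_def intro!: real_root_ge_zero divide_nonneg_nonneg)
  have split: "(\<Sum>i\<in>V. f i) = (\<Sum>i\<in>S. f i) + (\<Sum>i\<in>V - S. f i)" for f :: "'a \<Rightarrow> real"
    using sum.subset_diff[OF assms(8) finV, of f] by simp
  have km: "(\<Sum>i\<in>V. ?d i) = real k * real m"
    using sum_edges_sum_vertices[OF G, of "\<lambda>_. 1"] G assms(7)
    by (simp add: uniform_hypergraph_def mult.commute)
  \<comment> \<open>The quotient is kept because it is 0 for \<open>D = 0\<close>; the bound by
    \<open>s\<close> then holds without a case distinction.\<close>
  have "(\<Sum>i\<in>S. y i ^ k) = real s * D / D"
    using k D by (simp add: y_def D_def divide_nonneg_nonneg flip: sum_distrib_left sum_divide_distrib)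
  also have "\<dots> \<le> real s" by simp
  finally have "(\<Sum>i\<in>S. y i ^ k) \<le> real s" .
  moreover have "(\<Sum>i\<in>V - S. y i ^ k) = real n - real s"
    using assms(6,8,10) finV finS card_mono[OF finV assms(8)]
    by (simp add: y_def card_Diff_subset of_nat_diff)
  ultimately have "(\<Sum>i\<in>V. y i ^ k) \<le> real n"
    using split[of "\<lambda>i. y i ^ k"] by simp
  then have N: "(\<Sum>i\<in>V. (y i ^ k + (real k - 1)) / real k) \<le> real n"
    using k assms(6) unfolding sum_divide_distrib[symmetric] sum.distrib
    by (simp add: divide_simps algebra_simps)
  have "\<alpha> * (\<Sum>i\<in>V. ?d i * z i ^ k) + (1 - \<alpha>) * (\<Sum>i\<in>V. ?d i * y i) \<le>
      \<alpha> * (\<Sum>i\<in>V. ?d i * ((y i ^ k + (real k - 1)) / real k)) + (1 - \<alpha>) * (\<Sum>i\<in>V. ?d i * y i)"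
    unfolding z_def using assms(2) k y
    by (intro add_right_mono mult_left_mono sum_mono shifted_power_mean) auto
  also have "\<dots> \<le> rho_alpha k V E \<alpha> * (\<Sum>i\<in>V. (y i ^ k + (real k - 1)) / real k)"
    using rho_alpha_ge_linear[OF G assms(5) k V assms(2,3), of y] y by simp
  \<comment> \<open>Enlarging the second factor to \<open>n\<close> relies on
    \<open>rho_alpha_nonneg\<close>.\<close>
  also have "\<dots> \<le> rho_alpha k V E \<alpha> * real n"
    using N rho_alpha_nonneg[OF G assms(5) k V assms(2,3)] by (intro mult_left_mono)
  finally have main: "\<alpha> * (\<Sum>i\<in>V. ?d i * z i ^ k) + (1 - \<alpha>) * (\<Sum>i\<in>V. ?d i * y i)
    \<le> rho_alpha k V E \<alpha> * real n" .
  \<comment> \<open>Off \<open>S\<close> both \<open>y\<close> and \<open>z\<close> are 1, so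
    subtracting the degree sum \<open>k * m\<close> leaves only the vertices of
    \<open>S\<close>.\<close>
  have "(\<Sum>i\<in>V. ?d i * z i ^ k) - (\<Sum>i\<in>V. ?d i) = (\<Sum>i\<in>S. ?d i * z i ^ k) - (\<Sum>i\<in>S. ?d i)"
    using k by (simp add: split y_def z_def)
  also have "\<dots> = (\<Sum>i\<in>S. ?d i * ((y i + real k - 1) ^ k - real k ^ k)) / real k ^ k"
    unfolding sum_divide_distrib sum_subtractf[symmetric]
    using k by (intro sum.cong refl) (simp only: z_def power_divide, simp add: field_simps)
  finally have 1: "(\<Sum>i\<in>V. ?d i * z i ^ k) =
      (\<Sum>i\<in>S. ?d i * ((y i + real k - 1) ^ k - real k ^ k)) / real k ^ k + real k * real m"
    by (simp add: km)
  have "(\<Sum>i\<in>V. ?d i * y i) - (\<Sum>i\<in>V. ?d i) = (\<Sum>i\<in>S. ?d i * y i) - (\<Sum>i\<in>S. ?d i)"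
    by (simp add: split y_def)
  also have "(\<Sum>i\<in>S. ?d i * y i) = real s powr (1 / real k) * D powr ((real k - 1) / real k)"
    using Hoelder_equality_weights[of k S ?d "real s"] assms(1) by (simp add: y_def D_def)
  finally have 2: "(\<Sum>i\<in>V. ?d i * y i) =
      real s powr (1 / real k) * D powr ((real k - 1) / real k) - (\<Sum>i\<in>S. ?d i) + real k * real m"
    by (simp add: km)
  define A where "A = (\<Sum>i\<in>S. ?d i * ((y i + real k - 1) ^ k - real k ^ k))"
  define B where "B = real s powr (1 / real k) * D powr ((real k - 1) / real k) - (\<Sum>i\<in>S. ?d i)"
  have "\<alpha> * (A / real k ^ k) + (1 - \<alpha>) * B + real k * real m \<le> rho_alpha k V E \<alpha> * real n"
    using main unfolding 1 2 A_def[symmetric] B_def[symmetric] by (simp add: algebra_simps)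
  then have "(\<alpha> * (A / real k ^ k) + (1 - \<alpha>) * B + real k * real m) / real n \<le> rho_alpha k V E \<alpha>"
    using n by (simp only: pos_divide_le_eq)
  then have "\<alpha> / (real k ^ k * real n) * A + (1 - \<alpha>) / real n * B
      \<le> rho_alpha k V E \<alpha> - real k * real m / real n"
    by (simp add: add_divide_distrib)
  moreover have "A =
      (\<Sum>i\<in>S. ?d i * ((root k (real s * ?d i powr ?q / D) + real k - 1) ^ k - real k ^ k))"
    unfolding A_def by (intro sum.cong) (auto simp: y_def)
  ultimately show ?thesis by (simp add: D_def B_def)
qed

end
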